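(* Let $\mathbf k$ be a field of characteristic $0$, $\lambda\in\mathbf k$, and $\mathfrak g$ a vector space over $\mathbf k$. Let $\pi\in\mathrm{Hom}(\wedge^2\mathfrak g,\mathfrak g)$ and $D\in\mathrm{Hom}(\mathfrak g,\mathfrak g)$. Then $(s\pi,D)$ is a Maurer-Cartan element of the $L_\infty[1]$-algebra $sM\oplus A$ (described in the context, depending on $\lambda$) if and only if $(\mathfrak g,\pi,D)$ is a differential Lie algebra of weight $\lambda$.
   Context: A differential Lie algebra of weight $\lambda$ is a Lie algebra $(\mathfrak g,[\,,])$ with a linear map $D:\mathfrak g\to\mathfrak g$ such that $D([x,y])=[D(x),y]+[x,D(y)]+\lambda[D(x),D(y)]$ for all $x,y\in\mathfrak g$. $\bar\wedge V=\bigoplus_{k\ge1}\wedge^kV$. $M=A=\mathrm{Hom}(\bar\wedge\mathfrak g,\mathfrak g)$ as graded spaces, with $\mathrm{Hom}(\wedge^{n+1}\mathfrak g,\mathfrak g)$ in degree $n$. Nijenhuis-Richardson bracket: $[f,g]_{\mathrm{NR}}=f\bar\circ g-(-1)^{pq}g\bar\circ f$ for $f,g$ of degrees $p,q$, where $f\bar\circ g(x_1,\dots,x_{p+q+1})=\sum_{\sigma\in\mathrm{Sh}(q+1,p)}\mathrm{sgn}(\sigma)f(g(x_{\sigma(1)},\dots,x_{\sigma(q+1)}),x_{\sigma(q+2)},\dots,x_{\sigma(p+q+1)})$. With $(sV)^n=V^{n+1}$, the $L_\infty[1]$-algebra $sM\oplus A$ has operations $l_2(sf,sg)=(-1)^{|f|}s[f,g]_{\mathrm{NR}}$,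 $l_2(sf,\xi)=[f,\xi]_{\mathrm{NR}}$, and for $3\le i\le n+2$ $$l_i(sf,\xi_1,\dots,\xi_{i-1})=\sum_{\tau\in\mathrm{Sh}(m_{i-1}+1,\dots,m_1+1,n+2-i)}(-1)^{\sum_{j=1}^{i-1}(m_1+\cdots+m_{j-1})m_j}\lambda^{i-2}f(\xi_{i-1}\otimes\cdots\otimes\xi_1\otimes\mathrm{Id}^{\otimes n+2-i})\tau^{-1}$$ for $f\in\mathrm{Hom}(\wedge^{n+1}\mathfrak g,\mathfrak g)\subseteq M$, $g\in M$, $\xi\in A$, $\xi_j\in\mathrm{Hom}(\wedge^{m_j+1}\mathfrak g,\mathfrak g)\subseteq A$, extended by graded symmetry, all other components zero. Here $\tau^{-1}(x_1,\dots,x_t)=\mathrm{sgn}(\tau)(x_{\tau(1)},\dots,x_{\tau(t)})$, $\mathrm{Sh}$ denotes multi-shuffles, and the tensor product of maps is evaluated by the Koszul rule with $|\xi_j|=m_j$ and elements of $\mathfrak g$ treated as odd (no sign arises when all $m_j=0$). A Maurer-Cartan element is a degree $0$ element $\alpha$ with $\sum_{n\ge1}\frac1{n!}l_n(\alpha^{\otimes n})=0$. *)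

theory Defs
  imports
    Complex_Main
    "HOL-Combinatorics.Permutations"
    "HOL-Library.Function_Algebras"
    "HOL-Library.Product_Plus"
begin

section \<open>Differential Lie algebras of weight \<open>\<lambda>\<close>\<close>

locale lie_algebra = vector_space scale
  for scale :: "'k::field \<Rightarrow> 'g::ab_group_add \<Rightarrow> 'g" +
  fixes br :: "'g \<Rightarrow> 'g \<Rightarrow> 'g"
  assumes linear_left: "Vector_Spaces.linear scale scale (\<lambda>x. br x y)"
    and linear_right: "Vector_Spaces.linear scale scale (\<lambda>y. br x y)"
    and alternating: "br x x = 0"
    and jacobi: "br x (br y z) + br y (br z x) + br z (br x y) = 0"

locale differential_lie_algebra = lie_algebra scale br
  for scale :: "'k::field \<Rightarrow> 'g::ab_group_add \<Rightarrow> 'g" and br :: "'g \<Rightarrow> 'g \<Rightarrow> 'g" +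
  fixes D :: "'g \<Rightarrow> 'g" and lam :: 'k
  assumes linear_D: "Vector_Spaces.linear scale scale D"
    and derivation: "D (br x y) = br (D x) y + br x (D y) + scale lam (br (D x) (D y))"


section \<open>The graded space \<open>Hom(\<wedge>\<^sup>\<bullet>g, g)\<close>\<close>

text \<open>
  Linear maps \<open>\<wedge>\<^sup>k g \<rightarrow> g\<close> are represented as alternating \<open>k\<close>-linear maps whose
  arguments form a list of length \<open>k\<close>. The value on lists of any other length is fixed to be
  \<open>0\<close>, so that equality of maps is equality of functions.
\<close>

type_synonym 'g cochain = "'g list \<Rightarrow> 'g"

definition hom_wedge :: "('k::field \<Rightarrow> 'g::ab_group_add \<Rightarrow> 'g) \<Rightarrow> nat \<Rightarrow> 'g cochain set" where
  "hom_wedge scale k = {f.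
     (\<forall>xs. length xs \<noteq> k \<longrightarrow> f xs = 0) \<and>
     (\<forall>xs i. length xs = k \<longrightarrow> i < k \<longrightarrow>
        Vector_Spaces.linear scale scale (\<lambda>x. f (xs[i := x]))) \<and>
     (\<forall>xs. length xs = k \<longrightarrow> \<not> distinct xs \<longrightarrow> f xs = 0)}"

text \<open>The homogeneous part of degree \<open>n\<close>; the reduced exterior algebra has no \<open>\<wedge>\<^sup>0\<close>.\<close>

definition hom_degree :: "('k::field \<Rightarrow> 'g::ab_group_add \<Rightarrow> 'g) \<Rightarrow> int \<Rightarrow> 'g cochain set" where
  "hom_degree scale n = (if n \<ge> 0 then hom_wedge scale (nat n + 1) else {0})"


section \<open>Shuffles and the Nijenhuis-Richardson bracket\<close>

text \<open>
  Permutations of \<open>{0,\<dots>,t-1}\<close>, with \<open>t\<close> the sum of the block sizes \<open>ks\<close>, that are increasing on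
  each of the consecutive blocks of sizes \<open>ks\<close>. Note that
  \<open>permute_list \<sigma> [x\<^sub>0,\<dots>]  =  [x\<^bsub>\<sigma> 0\<^esub>, x\<^bsub>\<sigma> 1\<^esub>, \<dots>]\<close>.
\<close>

definition multi_shuffles :: "nat list \<Rightarrow> (nat \<Rightarrow> nat) set" where
  "multi_shuffles ks = {\<sigma>. \<sigma> permutes {..<sum_list ks} \<and>
     (\<forall>b<length ks. strict_mono_on {sum_list (take b ks)..<sum_list (take (Suc b) ks)} \<sigma>)}"

definition nr_circ ::
  "('k::field \<Rightarrow> 'g::ab_group_add \<Rightarrow> 'g) \<Rightarrow> nat \<Rightarrow> nat \<Rightarrow> 'g cochain \<Rightarrow> 'g cochain \<Rightarrow> 'g cochain" where
  "nr_circ scale p q f g = (\<lambda>xs.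
     if length xs = p + q + 1
     then \<Sum>\<sigma>\<in>multi_shuffles [q + 1, p].
            let ys = permute_list \<sigma> xs
            in scale (of_int (sign \<sigma>)) (f (g (take (q + 1) ys) # drop (q + 1) ys))
     else 0)"

definition nr_bracket ::
  "('k::field \<Rightarrow> 'g::ab_group_add \<Rightarrow> 'g) \<Rightarrow> nat \<Rightarrow> nat \<Rightarrow> 'g cochain \<Rightarrow> 'g cochain \<Rightarrow> 'g cochain" where
  "nr_bracket scale p q f g =
     (\<lambda>xs. nr_circ scale p q f g xs - scale ((-1) ^ (p * q)) (nr_circ scale q p g f xs))"


section \<open>The operations of \<open>sM \<oplus> A\<close>\<close>

text \<open>
  For homogeneous maps \<open>h\<^sub>1,\<dots>,h\<^sub>r\<close> of degrees \<open>m\<^sub>1,\<dots>,m\<^sub>r\<close>, given as a list of pairs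
  \<open>(m\<^sub>j, h\<^sub>j)\<close>, \<open>tensor_apply\<close> evaluates \<open>h\<^sub>1 \<otimes> \<dots> \<otimes> h\<^sub>r \<otimes> Id \<otimes> \<dots> \<otimes> Id\<close> up to sign;
  \<open>koszul_exponent\<close> is the exponent of the sign: each of \<open>h\<^sub>2,\<dots>,h\<^sub>r\<close> is moved past the
  \<open>m\<^sub>1 + 1\<close> odd arguments of \<open>h\<^sub>1\<close>, and so on.
\<close>

fun tensor_apply :: "(nat \<times> 'g cochain) list \<Rightarrow> 'g list \<Rightarrow> 'g list" where
  "tensor_apply [] xs = xs"
| "tensor_apply ((m, h) # hs) xs = h (take (m + 1) xs) # tensor_apply hs (drop (m + 1) xs)"

fun koszul_exponent :: "nat list \<Rightarrow> nat" where
  "koszul_exponent [] = 0"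
| "koszul_exponent (m # ms) = (m + 1) * sum_list ms + koszul_exponent ms"

text \<open>
  \<open>l\<^sub>i(sf, \<xi>\<^sub>1, \<dots>, \<xi>\<^bsub>i-1\<^esub>)\<close> with \<open>f\<close> of degree \<open>n\<close> in \<open>M\<close> and \<open>xis\<close> the list of the pairs
  \<open>(m\<^sub>j, \<xi>\<^sub>j)\<close>, so that \<open>i = length xis + 1\<close>.
\<close>

definition higher_op ::
  "('k::field \<Rightarrow> 'g::ab_group_add \<Rightarrow> 'g) \<Rightarrow> 'k \<Rightarrow> nat \<Rightarrow> 'g cochain \<Rightarrow> (nat \<times> 'g cochain) list
     \<Rightarrow> 'g cochain" where
  "higher_op scale lam n f xis =
     (let i = length xis + 1;
          ms = map fst xis;
          blocks = map (\<lambda>m. m + 1) (rev ms) @ [n + 2 - i]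
      in (\<lambda>xs.
        if length xs = sum_list blocks
        then \<Sum>\<tau>\<in>multi_shuffles blocks.
               scale ((-1) ^ (\<Sum>j<length ms. sum_list (take j ms) * ms ! j)
                       * lam ^ (i - 2)
                       * of_int (sign \<tau>)
                       * (-1) ^ koszul_exponent (rev ms))
                 (f (tensor_apply (rev xis) (permute_list \<tau> xs)))
        else 0))"

definition mixed_op ::
  "('k::field \<Rightarrow> 'g::ab_group_add \<Rightarrow> 'g) \<Rightarrow> 'k \<Rightarrow> nat \<Rightarrow> 'g cochain \<Rightarrow> (nat \<times> 'g cochain) list
     \<Rightarrow> 'g cochain" where
  "mixed_op scale lam n f xis =
     (let i = length xis + 1
      in if i = 2 then nr_bracket scale n (fst (hd xis)) f (snd (hd xis))
         else if 3 \<le> i \<and> i \<le> n + 2 then higher_op scale lam n f xis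
         else 0)"

text \<open>
  An element of \<open>sM \<oplus> A\<close> of degree \<open>d\<close> is a pair \<open>(f, \<xi>)\<close>, standing for \<open>sf + \<xi>\<close>, where \<open>f\<close> has
  degree \<open>d + 1\<close> in \<open>M\<close> and \<open>\<xi>\<close> has degree \<open>d\<close> in \<open>A\<close>.
\<close>

definition sMA :: "('k::field \<Rightarrow> 'g::ab_group_add \<Rightarrow> 'g) \<Rightarrow> int \<Rightarrow> ('g cochain \<times> 'g cochain) set" where
  "sMA scale d = hom_degree scale (d + 1) \<times> hom_degree scale d"

definition sMA_scale ::
  "('k::field \<Rightarrow> 'g::ab_group_add \<Rightarrow> 'g) \<Rightarrow> 'k \<Rightarrow> 'g cochain \<times> 'g cochain \<Rightarrow> 'g cochain \<times> 'g cochain"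
  where "sMA_scale scale c \<alpha> = (\<lambda>xs. scale c (fst \<alpha> xs), \<lambda>xs. scale c (snd \<alpha> xs))"

text \<open>
  All the operations \<open>l\<^sub>i\<close>, \<open>i \<ge> 1\<close>, in one function: its argument is the list of the \<open>i\<close> inputs,
  each tagged with its degree. It is the expansion of
  \<open>l\<^sub>i(sf\<^sub>1 + \<xi>\<^sub>1, \<dots>, sf\<^sub>i + \<xi>\<^sub>i)\<close> by multilinearity. The only terms that can be nonzero are
  \<open>l\<^sub>2(sf\<^sub>1, sf\<^sub>2)\<close> and, for each position \<open>j\<close>, the term with \<open>sf\<^sub>j\<close> and all the other \<open>\<xi>\<close>s; in the
  latter graded symmetry moves \<open>sf\<^sub>j\<close> to the front past \<open>\<xi>\<^sub>1, \<dots>, \<xi>\<^bsub>j-1\<^esub>\<close>. Truncating a negative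
  degree with \<open>nat\<close> is harmless, because the corresponding map is then \<open>0\<close>.
\<close>

definition sMA_op ::
  "('k::field \<Rightarrow> 'g::ab_group_add \<Rightarrow> 'g) \<Rightarrow> 'k \<Rightarrow> (int \<times> ('g cochain \<times> 'g cochain)) list
     \<Rightarrow> 'g cochain \<times> 'g cochain" where
  "sMA_op scale lam \<alpha>s =
     (let deg = (\<lambda>j. fst (\<alpha>s ! j));
          f = (\<lambda>j. fst (snd (\<alpha>s ! j)));
          mdeg = (\<lambda>j. nat (deg j + 1));
          xis = map (\<lambda>(d, \<alpha>). (nat d, snd \<alpha>)) \<alpha>s
      in (if length \<alpha>s = 2
          then \<lambda>xs. scale ((-1) ^ mdeg 0) (nr_bracket scale (mdeg 0) (mdeg 1) (f 0) (f 1) xs)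
          else 0,
          \<lambda>xs. \<Sum>j<length \<alpha>s.
            scale ((-1) powi (deg j * (\<Sum>k<j. deg k)))
              (mixed_op scale lam (mdeg j) (f j) (take j xis @ drop (Suc j) xis) xs)))"


section \<open>Maurer-Cartan elements\<close>

text \<open>
  Here \<open>V\<close> is the family of homogeneous parts of a graded space, and \<open>l\<close> takes a list of inputs
  tagged with their degrees. The Maurer-Cartan series is required to have only finitely many
  nonzero terms, so that its sum makes sense.
\<close>

definition maurer_cartan ::
  "('k::field_char_0 \<Rightarrow> 'v::ab_group_add \<Rightarrow> 'v) \<Rightarrow> (int \<Rightarrow> 'v set) \<Rightarrow> ((int \<times> 'v) list \<Rightarrow> 'v)
     \<Rightarrow> 'v \<Rightarrow> bool" where
  "maurer_cartan scale V l \<alpha> \<longleftrightarrow>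
     (let N = {n. n \<ge> 1 \<and> l (replicate n (0, \<alpha>)) \<noteq> 0}
      in \<alpha> \<in> V 0 \<and> finite N \<and>
         (\<Sum>n\<in>N. scale (1 / fact n) (l (replicate n (0, \<alpha>)))) = 0)"

end

theory Submission
  imports Defs
begin

text \<open>
  Only the terms with \<open>n = 2\<close> and \<open>n = 3\<close> of the Maurer-Cartan series of \<open>(s\<pi>, D)\<close> survive, since
  \<open>\<pi>\<close> takes at most two copies of \<open>D\<close>. The \<open>sM\<close>-component of the series is \<open>-1/2\<close> times the
  Nijenhuis-Richardson bracket of \<open>\<pi>\<close> with itself, which is the Jacobiator. In the \<open>A\<close>-component,
  \<open>l\<^sub>2\<close> contributes the bracket of \<open>\<pi>\<close> and \<open>D\<close>, and \<open>l\<^sub>3\<close> contributes \<open>\<lambda> \<pi>(D x, D y)\<close>: the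
  \<open>3\<close> positions of \<open>s\<pi>\<close> and the \<open>2\<close> shuffles cancel the factor \<open>1/3!\<close>. Their sum is the defect of
  the derivation rule of weight \<open>\<lambda>\<close>.
\<close>

section \<open>Shuffles of two and three letters\<close>

lemma permutes_lessThan_2:
  "\<sigma> permutes {..<2::nat} \<longleftrightarrow> \<sigma> = id \<or> \<sigma> = transpose 0 1"
proof
  assume \<sigma>: "\<sigma> permutes {..<2}"
  have "\<sigma> 0 < 2" "\<sigma> 1 < 2" "\<sigma> 0 \<noteq> \<sigma> 1"
    using permutes_in_image[OF \<sigma>] permutes_inj[OF \<sigma>] by (auto simp: inj_eq)
  moreover have "\<sigma> x = x" if "x \<ge> 2" for x
    using permutes_not_in[OF \<sigma>] that by auto
  ultimately have *: "\<sigma> 0 = 0 \<and> \<sigma> 1 = 1 \<or> \<sigma> 0 = 1 \<and> \<sigma> 1 = 0" "\<And>x. x \<noteq> 0 \<Longrightarrow> x \<noteq> 1 \<Longrightarrow> \<sigma> x = x"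
    by (auto simp: less_2_cases_iff)
  from *(1) show "\<sigma> = id \<or> \<sigma> = transpose 0 1"
  proof
    assume "\<sigma> 0 = 0 \<and> \<sigma> 1 = 1"
    then have "\<sigma> x = id x" for x using *(2)[of x] by (cases "x = 0"; cases "x = 1") auto
    then show ?thesis by blast
  next
    assume "\<sigma> 0 = 1 \<and> \<sigma> 1 = 0"
    then have "\<sigma> x = transpose 0 1 x" for x
      using *(2)[of x] by (cases "x = 0"; cases "x = 1") (auto simp: transpose_def)
    then show ?thesis by blast
  qed
qed (auto intro: permutes_swap_id)

lemma multi_shuffles_1_1: "multi_shuffles [1, 1] = {id, transpose 0 1}"
proof -
  have "\<sigma> \<in> multi_shuffles [1, 1] \<longleftrightarrow> \<sigma> permutes {..<2}" for \<sigma>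
    by (auto simp: multi_shuffles_def less_Suc_eq numeral_2_eq_2 strict_mono_on_def)
  then show ?thesis
    using permutes_lessThan_2 by blast
qed

text \<open>The empty last block occurs in \<open>l 3\<close>: two copies of \<open>D\<close> fill
  both slots of \<open>\<pi>\<close>, so \<open>n + 2 - i = 0\<close> identity factors
  remain.\<close>

lemma multi_shuffles_1_1_0: "multi_shuffles [1, 1, 0] = {id, transpose 0 1}"
proof -
  have "\<sigma> \<in> multi_shuffles [1, 1, 0] \<longleftrightarrow> \<sigma> permutes {..<2}" for \<sigma>
    by (auto simp: multi_shuffles_def less_Suc_eq numeral_2_eq_2 strict_mono_on_def)
  then show ?thesis
    using permutes_lessThan_2 by blast
qed

lemma multi_shuffles_2_0: "multi_shuffles [2, 0] = {id}"
proof -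
  have "\<not> strict_mono_on {0..<2} (transpose 0 (1::nat))"
    using strict_mono_onD[of "{0..<2}" "transpose 0 (1::nat)" 0 1] by auto
  then show ?thesis
    by (auto simp: multi_shuffles_def permutes_lessThan_2 less_Suc_eq strict_mono_on_def)
qed

text \<open>A (2,1)-shuffle is determined by its value at \<open>2\<close>. The composite is the
  3-cycle 0 -> 1 -> 2 -> 0, factored into transpositions to make its sign computable.\<close>

lemma multi_shuffles_2_1:
  "multi_shuffles [2, 1] = {id, transpose 1 2, transpose 0 1 \<circ> transpose 1 2}"
proof -
  have shuffle: "\<sigma> \<in> multi_shuffles [2, 1] \<longleftrightarrow> \<sigma> permutes {..<3} \<and> \<sigma> 0 < \<sigma> 1" for \<sigma>
    by (auto simp: multi_shuffles_def less_Suc_eq strict_mono_on_def less_2_cases_iff)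
  have eqI: "\<sigma> = \<tau>" if "\<sigma> permutes {..<3}" "\<tau> permutes {..<3}" "\<sigma> 0 = \<tau> 0" "\<sigma> 1 = \<tau> 1" "\<sigma> 2 = \<tau> 2"
    for \<sigma> \<tau> :: "nat \<Rightarrow> nat"
  proof
    fix x
    show "\<sigma> x = \<tau> x"
    proof (cases "x < 3")
      case True
      then have "x = 0 \<or> x = 1 \<or> x = 2" by auto
      then show ?thesis using that by auto
    next
      case False
      then show ?thesis using permutes_not_in[OF that(1)] permutes_not_in[OF that(2)] by auto
    qed
  qed
  have perms: "id permutes {..<3::nat}" "transpose 1 2 permutes {..<3::nat}"
    "transpose 0 1 \<circ> transpose 1 2 permutes {..<3::nat}"
    by (auto intro!: permutes_id permutes_swap_id permutes_compose)
  show ?thesis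
  proof (intro equalityI subsetI)
    fix \<sigma> assume "\<sigma> \<in> multi_shuffles [2, 1]"
    then have \<sigma>: "\<sigma> permutes {..<3}" "\<sigma> 0 < \<sigma> 1" unfolding shuffle by blast+
    have "\<sigma> 0 < 3" "\<sigma> 1 < 3" "\<sigma> 2 < 3" "\<sigma> 0 \<noteq> \<sigma> 2" "\<sigma> 1 \<noteq> \<sigma> 2"
      using permutes_in_image[OF \<sigma>(1)] permutes_inj[OF \<sigma>(1)] by (auto simp: inj_eq)
    with \<sigma>(2) consider "\<sigma> 0 = 0" "\<sigma> 1 = 1" "\<sigma> 2 = 2" | "\<sigma> 0 = 0" "\<sigma> 1 = 2" "\<sigma> 2 = 1"
      | "\<sigma> 0 = 1" "\<sigma> 1 = 2" "\<sigma> 2 = 0"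
      by linarith
    then show "\<sigma> \<in> {id, transpose 1 2, transpose 0 1 \<circ> transpose 1 2}"
    proof cases
      case 1
      then show ?thesis using eqI[OF \<sigma>(1) perms(1)] by simp
    next
      case 2
      then show ?thesis using eqI[OF \<sigma>(1) perms(2)] by (simp add: transpose_def)
    next
      case 3
      then show ?thesis using eqI[OF \<sigma>(1) perms(3)] by (simp add: transpose_def)
    qed
  next
    fix \<sigma> :: "nat \<Rightarrow> nat"
    assume "\<sigma> \<in> {id, transpose 1 2, transpose 0 1 \<circ> transpose 1 2}"
    then show "\<sigma> \<in> multi_shuffles [2, 1]"
      unfolding shuffle using perms by (auto simp: transpose_def)
  qed
qed

section \<open>Brackets and operations in low degree\<close>

context vector_space
begin

lemma hom_wedge_1_linear:
  assumes "f \<in> hom_wedge scale 1"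
  shows "Vector_Spaces.linear scale scale (\<lambda>x. f [x])"
  using assms by (auto simp: hom_wedge_def dest!: spec[of _ "[0]"] spec[of _ 0])

context
  fixes \<pi> :: "'b cochain"
  assumes \<pi>: "\<pi> \<in> hom_wedge scale 2"
begin

lemma hom_wedge_2_linear_left: "Vector_Spaces.linear scale scale (\<lambda>x. \<pi> [x, y])"
  and hom_wedge_2_linear_right: "Vector_Spaces.linear scale scale (\<lambda>x. \<pi> [y, x])"
proof -
  have "Vector_Spaces.linear scale scale (\<lambda>x. \<pi> (xs[i := x]))" if "length xs = 2" "i < 2" for xs i
    using \<pi> that by (auto simp: hom_wedge_def)
  \<comment> \<open>One entry of \<open>[y, y]\<close> is overwritten by the variable, the other is
    the fixed argument.\<close>
  from this[of "[y, y]" 0] this[of "[y, y]" 1]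
  show "Vector_Spaces.linear scale scale (\<lambda>x. \<pi> [x, y])"
    "Vector_Spaces.linear scale scale (\<lambda>x. \<pi> [y, x])"
    by simp_all
qed

lemma hom_wedge_2_alternating: "\<pi> [x, x] = 0"
  using \<pi> by (auto simp: hom_wedge_def)

text \<open>Polarization of the alternating law at \<open>x + y\<close>.\<close>

lemma hom_wedge_2_antisym: "\<pi> [y, x] = - \<pi> [x, y]"
proof -
  interpret L: Vector_Spaces.linear scale scale "\<lambda>x. \<pi> [x, c]" for c
    by (rule hom_wedge_2_linear_left)
  interpret R: Vector_Spaces.linear scale scale "\<lambda>x. \<pi> [c, x]" for c
    by (rule hom_wedge_2_linear_right)
  have "\<pi> [x, y] + \<pi> [y, x] = \<pi> [x + y, x + y]"
    by (simp add: L.add R.add hom_wedge_2_alternating[of x] hom_wedge_2_alternating[of y])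
  also have "\<dots> = 0"
    by (rule hom_wedge_2_alternating)
  finally show ?thesis
    by (simp add: eq_neg_iff_add_eq_0 add.commute)
qed

text \<open>The three shuffles give three terms with signs +, -, +; antisymmetry then moves each
  inner bracket to the second slot.\<close>

lemma nr_circ_2_2:
  "nr_circ scale 1 1 \<pi> \<pi> [x, y, z] = - (\<pi> [x, \<pi> [y, z]] + \<pi> [y, \<pi> [z, x]] + \<pi> [z, \<pi> [x, y]])"
proof -
  \<comment> \<open>The shuffles must be distinct for the sum over the set to split into three
    summands.\<close>
  have "transpose 0 1 \<circ> transpose 1 2 \<noteq> (id :: nat \<Rightarrow> nat)"
    "transpose 0 1 \<circ> transpose 1 2 \<noteq> (transpose 1 2 :: nat \<Rightarrow> nat)"
    "transpose 1 2 \<noteq> (id :: nat \<Rightarrow> nat)"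
    by (auto simp: fun_eq_iff transpose_def intro!: exI[of _ 2])
  moreover have "permutation (transpose a b)" for a b :: nat
    by (rule permutation_swap_id)
  moreover have "[0..<3] = [0, 1, 2::nat]" by (simp add: upt_rec)
  ultimately have "nr_circ scale 1 1 \<pi> \<pi> [x, y, z]
      = \<pi> [\<pi> [x, y], z] - \<pi> [\<pi> [x, z], y] + \<pi> [\<pi> [y, z], x]"
    by (simp add: nr_circ_def multi_shuffles_2_1[simplified] numeral_2_eq_2[symmetric]
        sign_compose sign_swap_id permute_list_def transpose_def Let_def)
  \<comment> \<open>Here antisymmetry is applied twice, outside and inside, so the signs cancel; the
    other two terms change sign once.\<close>
  moreover have "\<pi> [\<pi> [x, z], y] = \<pi> [y, \<pi> [z, x]]"
  proof -
    interpret R: Vector_Spaces.linear scale scale "\<lambda>x. \<pi> [c, x]" for c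
      by (rule hom_wedge_2_linear_right)
    have "\<pi> [\<pi> [x, z], y] = - \<pi> [y, \<pi> [x, z]]" by (rule hom_wedge_2_antisym)
    also have "\<dots> = \<pi> [y, - \<pi> [x, z]]" by (rule R.neg[symmetric])
    also have "- \<pi> [x, z] = \<pi> [z, x]" by (rule hom_wedge_2_antisym[symmetric])
    finally show ?thesis .
  qed
  ultimately show ?thesis
    using hom_wedge_2_antisym[of "\<pi> [x, y]" z] hom_wedge_2_antisym[of "\<pi> [y, z]" x] by simp
qed

lemma nr_bracket_2_1:
  "nr_bracket scale 1 0 \<pi> D [x, y] = \<pi> [D [x], y] + \<pi> [x, D [y]] - D [\<pi> [x, y]]"
  using hom_wedge_2_antisym[of "D [y]" x] transpose_eq_id_iff[of 0 "1::nat"]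
  by (simp add: nr_bracket_def nr_circ_def multi_shuffles_1_1[simplified] sign_swap_id
      multi_shuffles_2_0[simplified] numeral_2_eq_2[symmetric] permute_list_def upt_rec Let_def)

text \<open>The sign of the transposition cancels against the antisymmetry of \<open>\<pi>\<close>,
  so both shuffles contribute equally. All other signs are trivial because \<open>D\<close> has
  degree 0.\<close>

lemma higher_op_2_1_1:
  "higher_op scale lam 1 \<pi> [(0, D), (0, D)] [x, y] = scale (2 * lam) (\<pi> [D [x], D [y]])"
  using hom_wedge_2_antisym[of "D [y]" "D [x]"] scale_left_distrib[of lam lam "\<pi> [D [x], D [y]]"]
    transpose_eq_id_iff[of 0 "1::nat"]
  by (simp add: higher_op_def multi_shuffles_1_1_0[simplified] sign_swap_id
      permute_list_def upt_rec Let_def)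

end

end

section \<open>The Maurer-Cartan series\<close>

theorem theorem4p21:
  fixes scale :: "'k::field_char_0 \<Rightarrow> 'g::ab_group_add \<Rightarrow> 'g"
    and lam :: 'k
    and \<pi> D :: "'g list \<Rightarrow> 'g"
  assumes "vector_space scale"
    and "\<pi> \<in> hom_wedge scale 2"
    and "D \<in> hom_wedge scale 1"
  shows "maurer_cartan (sMA_scale scale) (sMA scale) (sMA_op scale lam) (\<pi>, D) \<longleftrightarrow>
         differential_lie_algebra scale (\<lambda>x y. \<pi> [x, y]) (\<lambda>x. D [x]) lam"
proof -
  interpret vector_space scale by fact
  note \<pi> = assms(2) and D = assms(3)
  define l where "l = (\<lambda>n. sMA_op scale lam (replicate n (0, (\<pi>, D))))"
  \<comment> \<open>The minus sign is \<open>(-1) ^ mdeg 0\<close> with \<open>mdeg 0 = 1\<close>.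
    The first 2 arises since \<open>\<pi>\<close> is odd, so its self-bracket adds two equal terms;
    the second counts the positions of \<open>\<pi>\<close>.\<close>
  have l2: "l 2 = (\<lambda>xs. - scale 2 (nr_circ scale 1 1 \<pi> \<pi> xs),
      \<lambda>xs. scale 2 (nr_bracket scale 1 0 \<pi> D xs))"
  proof -
    have two: "v + v = scale 2 v" for v
      using scale_left_distrib[of 1 1 v] by simp
    have "nr_bracket scale 1 1 \<pi> \<pi> xs = scale 2 (nr_circ scale 1 1 \<pi> \<pi> xs)" for xs
      by (simp add: nr_bracket_def two)
    then show ?thesis
      by (simp add: l_def sMA_op_def mixed_op_def numeral_2_eq_2 fun_eq_iff two)
  qed
  have l3: "l 3 = (0, \<lambda>xs. scale 3 (higher_op scale lam 1 \<pi> [(0, D), (0, D)] xs))"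
  proof -
    have three: "v + v + v = scale 3 v" for v
    proof -
      have "scale 3 v = scale (1 + 1 + 1) v" by simp
      also have "\<dots> = v + v + v" by (simp only: scale_left_distrib scale_one)
      finally show ?thesis by (rule sym)
    qed
    show ?thesis
      by (simp add: l_def sMA_op_def mixed_op_def numeral_3_eq_3 fun_eq_iff three)
  qed
  have l_other: "l n = 0" if "n \<noteq> 2" "n \<noteq> 3" for n
  proof -
    have mixed: "mixed_op scale lam 1 \<pi> xis = 0" if "length xis \<noteq> 1" "length xis \<noteq> 2" for xis
      using that by (auto simp: mixed_op_def)
    have "fst (l n) = 0"
      using that by (simp add: l_def sMA_op_def)
    moreover have "snd (l n) xs = 0" for xs
      unfolding l_def sMA_op_def Let_def snd_conv
      by (rule sum.neutral) (use that in \<open>simp add: mixed[simplified]\<close>)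
    ultimately show ?thesis
      by (simp add: prod_eq_iff fun_eq_iff)
  qed
  let ?N = "{n. n \<ge> 1 \<and> l n \<noteq> 0}"
  have N: "?N \<subseteq> {2, 3}" using l_other by auto
  \<comment> \<open>\<open>l 2\<close> or \<open>l 3\<close> may itself vanish, so \<open>?N\<close>
    can be smaller than \<open>{2, 3}\<close>; the added terms are zero.\<close>
  have "(\<Sum>n\<in>?N. sMA_scale scale (1 / fact n) (l n)) =
      (\<Sum>n\<in>{2, 3}. sMA_scale scale (1 / fact n) (l n))"
    by (rule sum.mono_neutral_left) (use N in \<open>auto simp: sMA_scale_def zero_prod_def zero_fun_def\<close>)
  \<comment> \<open>The factor 1/2 is 3/3!; it later cancels the 2 in
    \<open>higher_op_2_1_1\<close>.\<close>
  also have "\<dots> = (\<lambda>xs. - nr_circ scale 1 1 \<pi> \<pi> xs,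
      \<lambda>xs. nr_bracket scale 1 0 \<pi> D xs
        + scale (1 / 2) (higher_op scale lam 1 \<pi> [(0, D), (0, D)] xs))"
    by (simp add: l2 l3 sMA_scale_def fun_eq_iff fact_numeral)
  finally have series: "(\<Sum>n\<in>?N. sMA_scale scale (1 / fact n) (l n)) = \<dots>" .
  have "(\<pi>, D) \<in> sMA scale 0"
    using \<pi> D by (simp add: sMA_def hom_degree_def numeral_2_eq_2)
  moreover have "finite ?N"
    using N by (rule finite_subset) simp
  ultimately have "maurer_cartan (sMA_scale scale) (sMA scale) (sMA_op scale lam) (\<pi>, D) \<longleftrightarrow>
      (\<Sum>n\<in>?N. sMA_scale scale (1 / fact n) (l n)) = 0"
    by (simp only: maurer_cartan_def Let_def l_def simp_thms)
  also have "\<dots> \<longleftrightarrow>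
      (\<forall>xs. nr_circ scale 1 1 \<pi> \<pi> xs = 0) \<and>
      (\<forall>xs. nr_bracket scale 1 0 \<pi> D xs
        + scale (1 / 2) (higher_op scale lam 1 \<pi> [(0, D), (0, D)] xs) = 0)"
    unfolding series by (simp add: zero_prod_def fun_eq_iff)
  \<comment> \<open>Lists of any other length get the default value 0, so testing triples suffices;
    likewise pairs for the second component.\<close>
  also have "(\<forall>xs. nr_circ scale 1 1 \<pi> \<pi> xs = 0) \<longleftrightarrow>
      (\<forall>x y z. nr_circ scale 1 1 \<pi> \<pi> [x, y, z] = 0)"
  proof (intro iffI allI)
    fix xs assume *: "\<forall>x y z. nr_circ scale 1 1 \<pi> \<pi> [x, y, z] = 0"
    show "nr_circ scale 1 1 \<pi> \<pi> xs = 0"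
    proof (cases "length xs = 3")
      case True
      with * show ?thesis by (auto simp: numeral_3_eq_3 length_Suc_conv)
    qed (simp add: nr_circ_def)
  qed simp
  also have "\<dots> \<longleftrightarrow>
      (\<forall>x y z. \<pi> [x, \<pi> [y, z]] + \<pi> [y, \<pi> [z, x]] + \<pi> [z, \<pi> [x, y]] = 0)"
    by (simp only: nr_circ_2_2[OF \<pi>] neg_equal_0_iff_equal)
  also have "(\<forall>xs. nr_bracket scale 1 0 \<pi> D xs
        + scale (1 / 2) (higher_op scale lam 1 \<pi> [(0, D), (0, D)] xs) = 0) \<longleftrightarrow>
      (\<forall>x y. nr_bracket scale 1 0 \<pi> D [x, y]
        + scale (1 / 2) (higher_op scale lam 1 \<pi> [(0, D), (0, D)] [x, y]) = 0)"
    (is "(\<forall>xs. ?g xs = 0) \<longleftrightarrow> _")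
  proof (intro iffI allI)
    fix xs assume *: "\<forall>x y. ?g [x, y] = 0"
    show "?g xs = 0"
    proof (cases "length xs = 2")
      case True
      with * show ?thesis by (auto simp: numeral_2_eq_2 length_Suc_conv)
    qed (simp add: nr_bracket_def nr_circ_def higher_op_def Let_def numeral_2_eq_2)
  qed simp
  also have "\<dots> \<longleftrightarrow>
      (\<forall>x y. D [\<pi> [x, y]] = \<pi> [D [x], y] + \<pi> [x, D [y]] + scale lam (\<pi> [D [x], D [y]]))"
  proof -
    have "a - d + e = 0 \<longleftrightarrow> d = a + e" for a d e :: 'g
      using right_minus_eq[of "a + e" d] by (auto simp: algebra_simps)
    then show ?thesis
      by (simp only: nr_bracket_2_1[OF \<pi>] higher_op_2_1_1[OF \<pi>]) simp
  qed
  \<comment> \<open>The linearity and alternation axioms hold because \<open>\<pi>\<close> and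
    \<open>D\<close> are cochains, which leaves exactly these two identities.\<close>
  also have "(\<forall>x y z. \<pi> [x, \<pi> [y, z]] + \<pi> [y, \<pi> [z, x]] + \<pi> [z, \<pi> [x, y]] = 0) \<and> \<dots> \<longleftrightarrow>
      differential_lie_algebra scale (\<lambda>x y. \<pi> [x, y]) (\<lambda>x. D [x]) lam"
    using hom_wedge_2_linear_left[OF \<pi>] hom_wedge_2_linear_right[OF \<pi>]
      hom_wedge_2_alternating[OF \<pi>] hom_wedge_1_linear[OF D] vector_space_axioms
    by (simp only: differential_lie_algebra_def differential_lie_algebra_axioms_def
        lie_algebra_def lie_algebra_axioms_def simp_thms)
  finally show ?thesis .
qed

end
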